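(* For every integer $n\ge 3$ we have $f(n+3)>f(n)$.
   Context: For an integer $n\ge 3$, $f(n)$ denotes the least positive integer $k$ such that $\binom{n}{k}>\frac{2^n}{n+1}$. (Such a $k$ exists for all $n\ge 3$.) *)

theory Defs
  imports Complex_Main
begin

text \<open>The quotient is taken in the reals. The least element exists for every \<open>n \<ge> 3\<close>
  by \<open>binom_threshold_exists\<close> below; for \<open>n \<le> 1\<close> there is none and the value is unspecified.\<close>

definition binom_threshold :: "nat \<Rightarrow> nat" where
  "binom_threshold n = (LEAST k. 0 < k \<and> real (n choose k) > 2 ^ n / (real n + 1))"

lemma binom_threshold_exists:
  assumes "n \<ge> 3"
  shows "\<exists>k>0. real (n choose k) > 2 ^ n / (real n + 1)"
proof (rule ccontr)
  assume "\<not> ?thesis"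
  then have le: "real (n choose k) \<le> 2 ^ n / (real n + 1)" if "k > 0" for k
    using that by (meson not_less)
  have "n + 1 < 2 ^ n"
    using assms by (induction n rule: dec_induct) auto
  then have "real (n + 1) < real (2 ^ n)"
    by (simp only: of_nat_less_iff)
  then have lt: "real (n choose 0) < 2 ^ n / (real n + 1)"
    by (simp add: field_simps)
  have "(\<Sum>k\<le>n. real (n choose k)) < (\<Sum>k\<le>n. 2 ^ n / (real n + 1))"
  proof (rule sum_strict_mono_ex1)
    show "\<forall>k\<in>{..n}. real (n choose k) \<le> 2 ^ n / (real n + 1)"
      using le lt by (metis less_imp_le neq0_conv)
    show "\<exists>k\<in>{..n}. real (n choose k) < 2 ^ n / (real n + 1)"
      using lt by blast
  qed simp
  also have "\<dots> = 2 ^ n"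
    by (simp add: field_simps)
  also have "\<dots> = (\<Sum>k\<le>n. real (n choose k))"
    by (metis choose_row_sum of_nat_numeral of_nat_power of_nat_sum)
  finally show False by simp
qed

end

theory Submission
  imports Defs
begin

text \<open>
  The number \<open>2 ^ n / (n + 1)\<close> is the mean of the \<open>n\<close>-th row of Pascal's triangle, so the threshold
  is the position of the first entry \<open>n choose k\<close>, \<open>k > 0\<close>, above the mean of its row.

  Passing from entry \<open>k\<close> of row \<open>n\<close> to entry \<open>k + 1\<close> of row \<open>n + 3\<close> multiplies the binomial
  coefficient by
  \<open>(n + 1) (n + 2) (n + 3) / ((k + 1) (n + 1 - k) (n + 2 - k))\<close>
  and the mean of the row by \<open>8 (n + 1) / (n + 4)\<close>. Whenever the first factor is at most the second,
  which is an inequality between cubic polynomials, the property of being at most the mean moves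
  along this diagonal step (\<open>at_most_mean_diagonal\<close>). For large \<open>n\<close> and \<open>k = c n\<close> the inequality
  reads \<open>8 c (1 - c)\<^sup>2 > 1\<close>, which holds for \<open>c\<close> between about \<open>0.19\<close> and \<open>1/2\<close>.

  Let \<open>m\<close> be the threshold of \<open>n\<close>. Entry \<open>m - 1\<close> of row \<open>n\<close> is at most the mean, and a diagonal
  step gives the same for entry \<open>m\<close> of row \<open>n + 3\<close>, and by monotonicity for all entries before it;
  so the threshold of \<open>n + 3\<close> exceeds \<open>m\<close>. The step is justified once \<open>(n - 1) / 3 \<le> m \<le> n / 2\<close> and
  \<open>n \<ge> 11\<close> (\<open>cubic_inequality\<close>). The upper bound on \<open>m\<close> holds because the central entry is above the
  mean. The lower bound says that the entries with \<open>3 k + 2 \<le> n\<close> are at most the mean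
  (\<open>at_most_mean_first_third\<close>), and is itself proved by diagonal steps, along \<open>n = 3 k + 2\<close>. For
  \<open>n \<le> 10\<close> this lower bound, applied to row \<open>n + 3\<close>, already exceeds the threshold of \<open>n\<close>, which
  is found by evaluating one entry of the row.
\<close>

definition at_most_mean :: "nat \<Rightarrow> nat \<Rightarrow> bool" where
  "at_most_mean n k \<longleftrightarrow> (n choose k) * (n + 1) \<le> 2 ^ n"

lemma at_most_mean_iff_real:
  "at_most_mean n k \<longleftrightarrow> \<not> real (n choose k) > 2 ^ n / (real n + 1)"
proof -
  have "at_most_mean n k \<longleftrightarrow> real ((n choose k) * (n + 1)) \<le> real (2 ^ n)"
    by (simp only: at_most_mean_def of_nat_le_iff)
  also have "\<dots> \<longleftrightarrow> \<not> real (n choose k) > 2 ^ n / (real n + 1)"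
    by (simp add: not_less pos_le_divide_eq algebra_simps)
  finally show ?thesis .
qed

lemma binom_threshold_Least:
  "binom_threshold n = (LEAST k. 0 < k \<and> \<not> at_most_mean n k)"
  by (simp add: binom_threshold_def at_most_mean_iff_real)

lemma binom_threshold_pos_not_at_most_mean:
  assumes "n \<ge> 3"
  shows "0 < binom_threshold n \<and> \<not> at_most_mean n (binom_threshold n)"
proof -
  have "\<exists>k. 0 < k \<and> \<not> at_most_mean n k"
    using binom_threshold_exists[OF assms] by (auto simp: at_most_mean_iff_real)
  then show ?thesis
    unfolding binom_threshold_Least by (rule LeastI_ex)
qed

lemma binom_threshold_le:
  "0 < k \<Longrightarrow> \<not> at_most_mean n k \<Longrightarrow> binom_threshold n \<le> k"
  unfolding binom_threshold_Least by (simp add: Least_le)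

lemma at_most_mean_0: "at_most_mean n 0"
proof -
  have "Suc n \<le> 2 ^ n"
    by (induction n) auto
  then show ?thesis
    by (simp add: at_most_mean_def)
qed

lemma at_most_mean_below_binom_threshold:
  "k < binom_threshold n \<Longrightarrow> at_most_mean n k"
  using binom_threshold_le[of k n] at_most_mean_0 by (cases "k = 0") force+

lemma at_most_mean_mono:
  assumes "at_most_mean n k" "j \<le> k" "2 * k \<le> n"
  shows "at_most_mean n j"
proof -
  have "(n choose j) * (n + 1) \<le> (n choose k) * (n + 1)"
    using assms by (intro mult_right_mono binomial_mono) auto
  then show ?thesis
    using assms(1) by (simp add: at_most_mean_def)
qed

text \<open>Stepping down a column in the left half multiplies the entry by \<open>(n + 1) / (n + 1 - k)\<close>
  and the mean by \<open>2 (n + 1) / (n + 2)\<close>; the first factor is the smaller one as long as \<open>2 k \<le> n\<close>.\<close>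

lemma at_most_mean_down:
  assumes "at_most_mean n k" "2 * k \<le> n"
  shows "at_most_mean (Suc n) k"
proof -
  have absorb: "(Suc n - k) * (Suc n choose k) = Suc n * (n choose k)"
    using binomial_absorb_comp[of "Suc n" k] by simp
  have "(Suc n - k) * ((Suc n choose k) * (Suc n + 1)) = (n + 2) * ((n choose k) * (n + 1))"
    using absorb by (simp add: algebra_simps del: binomial_Suc_Suc)
  also have "\<dots> \<le> (2 * (Suc n - k)) * 2 ^ n"
    using assms by (intro mult_mono) (auto simp: at_most_mean_def)
  also have "\<dots> = (Suc n - k) * 2 ^ Suc n"
    by simp
  finally show ?thesis
    using assms(2) unfolding at_most_mean_def by (subst (asm) mult_le_cancel1) auto
qed

lemma choose_diagonal_step:
  "(k + 1) * (n + 2 - k) * (n + 1 - k) * ((n + 3) choose (k + 1))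
     = (n + 1) * (n + 2) * (n + 3) * (n choose k)"
proof -
  have 1: "(k + 1) * ((n + 3) choose (k + 1)) = (n + 3) * ((n + 2) choose k)"
    using binomial_absorption[of k "n + 3"] by simp
  have 2: "(n + 2 - k) * ((n + 2) choose k) = (n + 2) * ((n + 1) choose k)"
    using binomial_absorb_comp[of "n + 2" k] by simp
  have 3: "(n + 1 - k) * ((n + 1) choose k) = (n + 1) * (n choose k)"
    using binomial_absorb_comp[of "n + 1" k] by simp
  have "(k + 1) * (n + 2 - k) * (n + 1 - k) * ((n + 3) choose (k + 1))
      = (n + 2 - k) * (n + 1 - k) * ((k + 1) * ((n + 3) choose (k + 1)))"
    by (simp only: mult_ac)
  also have "\<dots> = (n + 3) * (n + 1 - k) * ((n + 2 - k) * ((n + 2) choose k))"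
    by (subst 1) (simp only: mult_ac)
  also have "\<dots> = (n + 3) * (n + 2) * ((n + 1 - k) * ((n + 1) choose k))"
    by (subst 2) (simp only: mult_ac)
  also have "\<dots> = (n + 1) * (n + 2) * (n + 3) * (n choose k)"
    by (subst 3) (simp only: mult_ac)
  finally show ?thesis .
qed

text \<open>The cubic hypothesis compares the growth of the entry along the diagonal step with that of the
  mean. In \<open>choose_diagonal_step\<close> the factor \<open>n + 1\<close> on the right combines with \<open>n choose k\<close> into
  the quantity bounded by \<open>2 ^ n\<close>, and \<open>n + 4\<close> takes its place in the cubic product.\<close>

lemma at_most_mean_diagonal:
  assumes le: "at_most_mean n k" and "k \<le> n"
    and cubic: "(n + 2) * (n + 3) * (n + 4) \<le> 8 * ((k + 1) * (n + 2 - k) * (n + 1 - k))"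
  shows "at_most_mean (n + 3) (k + 1)"
proof -
  let ?G = "(k + 1) * (n + 2 - k) * (n + 1 - k)"
  have "?G * (((n + 3) choose (k + 1)) * (n + 3 + 1))
      = (?G * ((n + 3) choose (k + 1))) * (n + 4)"
    by (simp only: mult.assoc add.assoc) (simp only: numeral_plus_one semiring_norm)
  also have "\<dots> = ((n + 2) * (n + 3) * (n + 4)) * ((n choose k) * (n + 1))"
    by (subst choose_diagonal_step) (simp only: mult_ac)
  also have "\<dots> \<le> (8 * ?G) * 2 ^ n"
    using cubic le unfolding at_most_mean_def by (rule mult_le_mono)
  also have "\<dots> = ?G * 2 ^ (n + 3)"
    by (simp add: power_add)
  finally have "?G * (((n + 3) choose (k + 1)) * (n + 3 + 1)) \<le> ?G * 2 ^ (n + 3)" .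
  moreover have "0 < ?G"
    using \<open>k \<le> n\<close> by simp
  ultimately show ?thesis
    unfolding at_most_mean_def by (subst (asm) mult_le_cancel1) blast
qed

text \<open>Along \<open>n = 3 k + 2\<close> the diagonal step is valid only from \<open>k = 2\<close> on, so the first entries are
  checked by hand. The bound is tight: for instance entry \<open>k\<close> of row \<open>3 k + 1\<close> is above the
  mean for \<open>1 \<le> k \<le> 5\<close>.\<close>

lemma at_most_mean_3k_plus_2: "at_most_mean (3 * k + 2) k"
proof (induction k)
  case 0
  show ?case by (rule at_most_mean_0)
next
  case (Suc k)
  show ?case
  proof (cases "k < 2")
    case True
    then have "k = 0 \<or> k = 1" by auto
    moreover have "at_most_mean 5 1" "at_most_mean 8 2"
      by (simp_all add: at_most_mean_def choose_two)
    ultimately show ?thesis by (auto simp: numeral_2_eq_2)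
  next
    case False
    then obtain d where k: "k = d + 2"
      by (metis add.commute le_Suc_ex not_less)
    have sub: "3 * k + 2 + 2 - k = 2 * d + 8" "3 * k + 2 + 1 - k = 2 * d + 7"
      using k by auto
    have "at_most_mean (3 * k + 2 + 3) (k + 1)"
      using Suc.IH
    proof (rule at_most_mean_diagonal)
      show "(3 * k + 2 + 2) * (3 * k + 2 + 3) * (3 * k + 2 + 4)
        \<le> 8 * ((k + 1) * (3 * k + 2 + 2 - k) * (3 * k + 2 + 1 - k))"
        unfolding sub unfolding k by (simp add: algebra_simps)
    qed simp
    then show ?thesis
      by (simp add: algebra_simps)
  qed
qed

lemma at_most_mean_first_third:
  assumes "3 * k + 2 \<le> n"
  shows "at_most_mean n k"
  using assms
proof (induction n rule: dec_induct)
  case base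
  show ?case by (rule at_most_mean_3k_plus_2)
next
  case (step n)
  then show ?case by (intro at_most_mean_down) auto
qed

lemma binom_threshold_lower:
  assumes "n \<ge> 3"
  shows "n \<le> 3 * binom_threshold n + 1"
  using binom_threshold_pos_not_at_most_mean[OF assms]
    at_most_mean_first_third[of "binom_threshold n" n]
  by linarith

text \<open>The central entry is the largest of the row; if it came before the threshold, no entry would
  exceed the mean.\<close>

lemma binom_threshold_upper:
  assumes "n \<ge> 3"
  shows "2 * binom_threshold n \<le> n"
proof (rule ccontr)
  assume "\<not> ?thesis"
  then have "at_most_mean n (n div 2)"
    by (intro at_most_mean_below_binom_threshold) auto
  moreover have "n choose binom_threshold n \<le> n choose (n div 2)"
    by (rule binomial_maximum)
  ultimately have "at_most_mean n (binom_threshold n)"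
    unfolding at_most_mean_def by (meson mult_le_mono1 order_trans)
  then show False
    using binom_threshold_pos_not_at_most_mean[OF assms] by blast
qed

text \<open>At \<open>n = 10\<close>, \<open>k = 2\<close> the inequality fails (\<open>2184 > 2160\<close>), so \<open>11\<close> is the right bound. The
  distances \<open>a\<close> and \<open>b\<close> of \<open>k + 1\<close> from the two ends of its range serve as new variables. They turn
  the claim into a cubic inequality whose leading form has nonnegative coefficients only.\<close>

lemma cubic_inequality:
  fixes n k :: nat
  assumes "n \<ge> 11" "n \<le> 3 * (k + 1) + 1" "2 * (k + 1) \<le> n"
  shows "(n + 2) * (n + 3) * (n + 4) \<le> 8 * ((k + 1) * (n + 2 - k) * (n + 1 - k))"
proof -
  define a where "a = int (3 * (k + 1) + 1) - int n"
  define b where "b = int n - int (2 * (k + 1))"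
  have a: "a \<ge> 0" and b: "b \<ge> 0" and ab: "2 * a + 3 * b \<ge> 13"
    using assms by (auto simp: a_def b_def)
  have n: "int n = 2 * a + 3 * b - 2" and k: "int k = a + b - 2"
    by (auto simp: a_def b_def)
  have "12 * a + 38 * b + 11 * b\<^sup>2 + 16 \<le> 4 * a\<^sup>2 * b + 10 * a * b\<^sup>2 + 5 * b ^ 3 + 4 * a\<^sup>2 + 4 * a * b"
    (is "?L \<le> ?R")
    \<comment> \<open>For \<open>b \<ge> 5\<close> the claim holds for every \<open>a \<ge> 0\<close>; for smaller \<open>b\<close> the bound
      \<open>2 a + 3 b \<ge> 13\<close>, that is \<open>n \<ge> 11\<close>, makes \<open>a\<close> large enough.\<close>
  proof (cases "b \<ge> 5")
    case True
    define c where "c = b - 5"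
    have "c \<ge> 0" and bc: "b = c + 5"
      using True by (auto simp: c_def)
    have "?R - ?L = 4 * a\<^sup>2 * c + 24 * a\<^sup>2 + 10 * a * c\<^sup>2 + 104 * a * c + 258 * a
        + 5 * c ^ 3 + 64 * c\<^sup>2 + 227 * c + 144"
      unfolding bc by (simp add: algebra_simps power2_eq_square power3_eq_cube)
    moreover have "\<dots> \<ge> 0"
      using a \<open>c \<ge> 0\<close> by simp
    ultimately show ?thesis by linarith
  next
    case False
    then consider "b = 0" | "b = 1" | "b = 2 \<or> b = 3 \<or> b = 4"
      using b by linarith
    then show ?thesis
    proof cases
      case 1
      then have "4 * ((a - 4) * (a + 1)) \<ge> 0"
        using ab by simp
      then show ?thesis
        using 1 by (simp add: algebra_simps power2_eq_square)
    next
      case 2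
      then have "(a - 5) * (8 * a + 42) \<ge> 0"
        using ab by simp
      then show ?thesis
        using 2 by (simp add: algebra_simps power2_eq_square)
    next
      case 3
      have sq: "a * a \<ge> 0"
        by simp
      show ?thesis
        using 3 ab
        by (elim disjE; simp add: power2_eq_square power3_eq_cube; use sq in linarith)
    qed
  qed
  then have "(2 * a + 3 * b) * (2 * a + 3 * b + 1) * (2 * a + 3 * b + 2)
      \<le> 8 * ((a + b - 1) * (a + 2 * b + 2) * (a + 2 * b + 1))"
    by (simp add: algebra_simps power2_eq_square power3_eq_cube)
  moreover have eqs: "int (n + 2 - k) = a + 2 * b + 2" "int (n + 1 - k) = a + 2 * b + 1"
    "int (k + 1) = a + b - 1" "int (n + 2) = 2 * a + 3 * b" "int (n + 3) = 2 * a + 3 * b + 1"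
    "int (n + 4) = 2 * a + 3 * b + 2"
    using assms n k by (simp_all add: of_nat_diff)
  ultimately have "int ((n + 2) * (n + 3) * (n + 4))
      \<le> int (8 * ((k + 1) * (n + 2 - k) * (n + 1 - k)))"
    by (simp only: of_nat_mult eqs of_nat_numeral)
  then show ?thesis
    by (simp only: of_nat_le_iff)
qed

text \<open>In these rows the very first entry that \<open>at_most_mean_first_third\<close> leaves open is already
  above the mean, so the threshold is \<open>(n + 1) div 3\<close>.\<close>

lemma binom_threshold_upper_small:
  assumes "3 \<le> n" "n \<le> 10"
  shows "3 * binom_threshold n \<le> n + 1"
proof -
  have "n \<in> {3, 4, 5, 6, 7, 8, 9, 10}"
    using assms by auto
  moreover have "\<not> at_most_mean 3 1" "\<not> at_most_mean 4 1" "\<not> at_most_mean 5 2"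
    "\<not> at_most_mean 6 2" "\<not> at_most_mean 7 2" "\<not> at_most_mean 8 3"
    "\<not> at_most_mean 9 3" "\<not> at_most_mean 10 3"
    by (simp_all add: at_most_mean_def binomial_fact' fact_numeral)
  ultimately have "\<not> at_most_mean n ((n + 1) div 3)"
    by auto
  then have "binom_threshold n \<le> (n + 1) div 3"
    using assms by (intro binom_threshold_le) auto
  then show ?thesis by linarith
qed

theorem theorem1p5:
  fixes n :: nat
  assumes "n \<ge> 3"
  shows "binom_threshold (n + 3) > binom_threshold n"
proof (cases "n \<le> 10")
  case True
  have "n + 3 \<le> 3 * binom_threshold (n + 3) + 1"
    by (rule binom_threshold_lower) simp
  then show ?thesis
    using binom_threshold_upper_small[OF assms True] by linarith
next
  case False
  define m where "m = binom_threshold n"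
  have lower: "n \<le> 3 * m + 1" and upper: "2 * m \<le> n" and "0 < m"
    using binom_threshold_lower[OF assms] binom_threshold_upper[OF assms]
      binom_threshold_pos_not_at_most_mean[OF assms]
    by (auto simp: m_def)
  then obtain k where k: "m = k + 1"
    by (metis Suc_eq_plus1 gr0_conv_Suc)
  have "at_most_mean n k"
    using k by (intro at_most_mean_below_binom_threshold) (simp add: m_def)
  then have "at_most_mean (n + 3) m"
    using False lower upper unfolding k
    by (intro at_most_mean_diagonal cubic_inequality) auto
  then have "at_most_mean (n + 3) j" if "j \<le> m" for j
    using that upper by (intro at_most_mean_mono[of "n + 3" m j]) auto
  moreover have "\<not> at_most_mean (n + 3) (binom_threshold (n + 3))"
    using binom_threshold_pos_not_at_most_mean[of "n + 3"] by simp
  ultimately show ?thesis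
    unfolding m_def by (meson not_le)
qed

end
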